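(* Let $n \geq 4$ be even and let $P_n$ denote the path on $n$ vertices. Then: (i) for $n = 4$: $\chi'(P^x_{4,c}) = 7$ and $\chi^+(P^x_{4,c}) = 9$; (ii) for $n \geq 6$: $\chi'(P^x_{n,c}) = \frac{3n}{2}$ and $\chi^+(P^x_{n,c}) = \frac{5n}{2} - 1$.
   Context: All graphs are simple, connected, finite and undirected. Chromatic sums. For a graph $F$ with chromatic number $k = \chi(F)$, a minimum proper coloring of $F$ is a proper vertex coloring using the $k$ colors $c_1, \dots, c_k$; for such a coloring, $\theta(c_i)$ is the number of vertices receiving color $c_i$. Define $\chi'(F) = \min \sum_{i=1}^{k} i\cdot\theta(c_i)$ and $\chi^+(F) = \max \sum_{i=1}^{k} i\cdot\theta(c_i)$, where the minimum and maximum are taken over all minimum proper colorings of $F$ (all assignments of the indexed colors $c_1,\dots,c_k$). Complete degree-extensions. Let $G$ be a graph of even order. If $M$ is a perfect matching of the complement graph $G^c$, then the graph $G + M$ (obtained from $G$ by adding all edges of $M$) is called a complete degree-extension of $G$. If $G^c$ has at least one perfect matching and $G^{x_1}_c, \dots, G^{x_\ell}_c$ are, up to isomorphism, all the complete degree-extensions of $G$, define $\chi'(G^x_c) = \min\{\chi'(G^{x_i}_c) : 1 \leq i \leq \ell\}$ and $\chi^+(G^x_c) = \max\{\chi^+(G^{x_i}_c) : 1 \leq i \leq \ell\}$. For $G = P_n$ these are written $\chi'(P^x_{n,c})$ and $\chi^+(P^x_{n,c})$. *)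

theory Defs
  imports Complex_Main
begin

record 'a graph =
  verts :: "'a set"
  edges :: "'a set set"

definition simple_graph :: "'a graph \<Rightarrow> bool" where
  "simple_graph G \<longleftrightarrow>
     finite (verts G) \<and>
     edges G \<subseteq> {{u, v} | u v. u \<in> verts G \<and> v \<in> verts G \<and> u \<noteq> v}"

definition complement :: "'a graph \<Rightarrow> 'a graph" where
  "complement G =
     \<lparr>verts = verts G,
      edges = {{u, v} | u v. u \<in> verts G \<and> v \<in> verts G \<and> u \<noteq> v \<and> {u, v} \<notin> edges G}\<rparr>"

definition path_graph :: "nat \<Rightarrow> nat graph" where
  "path_graph n = \<lparr>verts = {1..n}, edges = {{i, i + 1} | i. 1 \<le> i \<and> i < n}\<rparr>"

definition perfect_matching :: "'a graph \<Rightarrow> 'a set set \<Rightarrow> bool" where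
  "perfect_matching G M \<longleftrightarrow> M \<subseteq> edges G \<and> (\<forall>v \<in> verts G. \<exists>!e. e \<in> M \<and> v \<in> e)"

definition add_edges :: "'a graph \<Rightarrow> 'a set set \<Rightarrow> 'a graph" where
  "add_edges G M = \<lparr>verts = verts G, edges = edges G \<union> M\<rparr>"

definition proper_colouring :: "'a graph \<Rightarrow> nat \<Rightarrow> ('a \<Rightarrow> nat) \<Rightarrow> bool" where
  "proper_colouring G k c \<longleftrightarrow>
     (\<forall>v \<in> verts G. c v \<in> {1..k}) \<and> (\<forall>u v. {u, v} \<in> edges G \<longrightarrow> c u \<noteq> c v)"

definition chromatic_number :: "'a graph \<Rightarrow> nat" where
  "chromatic_number G = (LEAST k. \<exists>c. proper_colouring G k c)"

text \<open>By minimality of the chromatic number, every colour in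
  \<open>{1..chromatic_number G}\<close> is used by such a colouring.\<close>

definition minimum_colouring :: "'a graph \<Rightarrow> ('a \<Rightarrow> nat) \<Rightarrow> bool" where
  "minimum_colouring G c \<longleftrightarrow> proper_colouring G (chromatic_number G) c"

definition colour_weight :: "'a graph \<Rightarrow> ('a \<Rightarrow> nat) \<Rightarrow> nat \<Rightarrow> nat" where
  "colour_weight G c i = card {v \<in> verts G. c v = i}"

definition colouring_sum :: "'a graph \<Rightarrow> ('a \<Rightarrow> nat) \<Rightarrow> nat" where
  "colouring_sum G c = (\<Sum>i = 1..chromatic_number G. i * colour_weight G c i)"

definition min_chromatic_sum :: "'a graph \<Rightarrow> nat" where
  "min_chromatic_sum G = Min {colouring_sum G c | c. minimum_colouring G c}"

definition max_chromatic_sum :: "'a graph \<Rightarrow> nat" where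
  "max_chromatic_sum G = Max {colouring_sum G c | c. minimum_colouring G c}"

definition complete_extensions :: "'a graph \<Rightarrow> 'a graph set" where
  "complete_extensions G = {add_edges G M | M. perfect_matching (complement G) M}"

text \<open>The extremal values range over all complete degree-extensions on the given vertex set
  rather than over representatives of their isomorphism classes. The values are the same,
  because the chromatic sums are isomorphism invariant (\<open>chromatic_sums_iso\<close> below). They are
  meaningful only if the complement has a perfect matching, since \<open>Min {}\<close> and \<open>Max {}\<close> are
  unspecified.\<close>

definition min_extension_sum :: "'a graph \<Rightarrow> nat" where
  "min_extension_sum G = Min (min_chromatic_sum ` complete_extensions G)"

definition max_extension_sum :: "'a graph \<Rightarrow> nat" where
  "max_extension_sum G = Max (max_chromatic_sum ` complete_extensions G)"

lemma simple_graph_path_graph: "simple_graph (path_graph n)"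
  unfolding simple_graph_def path_graph_def by force

lemma simple_graph_extension:
  assumes "simple_graph G" "H \<in> complete_extensions G"
  shows "simple_graph H"
proof -
  obtain M where M: "H = add_edges G M" "M \<subseteq> edges (complement G)"
    using assms(2) by (auto simp: complete_extensions_def perfect_matching_def)
  have "edges (complement G) \<subseteq> {{u, v} | u v. u \<in> verts G \<and> v \<in> verts G \<and> u \<noteq> v}"
    by (auto simp: complement_def)
  with M assms(1) show ?thesis
    unfolding simple_graph_def add_edges_def by auto
qed

definition graph_iso :: "('a \<Rightarrow> 'b) \<Rightarrow> 'a graph \<Rightarrow> 'b graph \<Rightarrow> bool" where
  "graph_iso f G H \<longleftrightarrow> bij_betw f (verts G) (verts H) \<and> edges H = (\<lambda>e. f ` e) ` edges G"

lemma graph_iso_inv: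
  assumes "simple_graph G" "graph_iso f G H"
  shows "graph_iso (inv_into (verts G) f) H G"
proof -
  have bij: "bij_betw f (verts G) (verts H)" and E: "edges H = (\<lambda>e. f ` e) ` edges G"
    using assms(2) by (auto simp: graph_iso_def)
  have "inv_into (verts G) f ` f ` e = e" if "e \<in> edges G" for e
    using that assms(1) bij
    by (intro inv_into_image_cancel) (auto simp: simple_graph_def bij_betw_def)
  then have "(\<lambda>e. inv_into (verts G) f ` e) ` edges H = edges G"
    by (simp add: E image_image)
  then show ?thesis
    using bij_betw_inv_into[OF bij] by (simp add: graph_iso_def)
qed

lemma proper_colouring_iso:
  assumes "simple_graph G" "graph_iso f G H" "proper_colouring H k c"
  shows "proper_colouring G k (c \<circ> f)"
proof -
  have "c (f u) \<noteq> c (f v)" if "{u, v} \<in> edges G" for u v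
  proof -
    have "{f u, f v} \<in> edges H"
      using assms(2) imageI[OF that, of "\<lambda>e. f ` e"] by (simp add: graph_iso_def)
    then show ?thesis using assms(3) by (simp add: proper_colouring_def)
  qed
  moreover have "f v \<in> verts H" if "v \<in> verts G" for v
    using assms(2) that by (auto simp: graph_iso_def bij_betw_def)
  ultimately show ?thesis
    using assms(3) by (simp add: proper_colouring_def)
qed

lemma chromatic_number_iso:
  assumes "simple_graph G" "simple_graph H" "graph_iso f G H"
  shows "chromatic_number G = chromatic_number H"
proof -
  have "(\<exists>c. proper_colouring G k c) \<longleftrightarrow> (\<exists>c. proper_colouring H k c)" for k
    using proper_colouring_iso[OF assms(1,3)]
      proper_colouring_iso[OF assms(2) graph_iso_inv[OF assms(1,3)]] by blast
  then show ?thesis by (simp add: chromatic_number_def)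
qed

lemma colouring_sum_iso:
  assumes "simple_graph G" "simple_graph H" "graph_iso f G H"
  shows "colouring_sum G (c \<circ> f) = colouring_sum H c"
proof -
  have bij: "bij_betw f (verts G) (verts H)" using assms(3) by (simp add: graph_iso_def)
  have "bij_betw f {v \<in> verts G. c (f v) = i} {v \<in> verts H. c v = i}" for i
    using bij by (auto simp: bij_betw_def inj_on_def)
  then have "colour_weight G (c \<circ> f) i = colour_weight H c i" for i
    unfolding colour_weight_def comp_def by (blast intro: bij_betw_same_card)
  then show ?thesis
    by (simp add: colouring_sum_def chromatic_number_iso[OF assms])
qed

lemma chromatic_sums_iso:
  assumes "simple_graph G" "simple_graph H" "graph_iso f G H"
  shows "min_chromatic_sum G = min_chromatic_sum H"
    and "max_chromatic_sum G = max_chromatic_sum H"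
proof -
  have sub: "{colouring_sum G c | c. minimum_colouring G c}
      \<subseteq> {colouring_sum H c | c. minimum_colouring H c}"
  proof -
    have "\<exists>c'. colouring_sum G c = colouring_sum H c' \<and> minimum_colouring H c'"
      if "minimum_colouring G c" for c
      using that proper_colouring_iso[OF assms(2) graph_iso_inv[OF assms(1,3)]]
        colouring_sum_iso[OF assms(2,1) graph_iso_inv[OF assms(1,3)], of c]
        chromatic_number_iso[OF assms]
      unfolding minimum_colouring_def by metis
    then show ?thesis by blast
  qed
  have "{colouring_sum H c | c. minimum_colouring H c}
      \<subseteq> {colouring_sum G c | c. minimum_colouring G c}"
  proof -
    have "\<exists>c'. colouring_sum H c = colouring_sum G c' \<and> minimum_colouring G c'"
      if "minimum_colouring H c" for c
      using that proper_colouring_iso[OF assms(1,3)] colouring_sum_iso[OF assms, of c]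
        chromatic_number_iso[OF assms]
      unfolding minimum_colouring_def by metis
    then show ?thesis by blast
  qed
  with sub show "min_chromatic_sum G = min_chromatic_sum H"
    "max_chromatic_sum G = max_chromatic_sum H"
    unfolding min_chromatic_sum_def max_chromatic_sum_def by simp_all
qed

end

theory Submission
  imports Defs
begin

text \<open>
  A complete degree-extension of \<open>P\<^sub>n\<close> is the path together with a fixed-point-free involution
  \<open>p\<close> that moves no vertex to a neighbour on the path. Colouring greedily along the path uses at
  most three colours, since vertex \<open>m + 1\<close> has only \<open>m\<close> and its partner as earlier neighbours.
  Twice the colour sum of \<open>c\<close> is the sum of \<open>c v + c (p v)\<close> over all \<open>v\<close>. Each summand is a sum
  of two distinct colours from \<open>{1, 2, 3}\<close>, hence lies between 3 and 5; and since colour 1 must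
  occur, at least two summands (at a vertex of colour 1 and at its partner) are at most 4. Explicit
  involutions attain the bounds; for \<open>n = 4\<close> the only extension is \<open>K\<^sub>4\<close> minus an edge.
\<close>

section \<open>Colourings and colour sums of arbitrary graphs\<close>

lemma chromatic_number_le: "proper_colouring G k c \<Longrightarrow> chromatic_number G \<le> k"
  unfolding chromatic_number_def by (blast intro: Least_le)

lemma proper_colouring_chromatic_number:
  "proper_colouring G k c \<Longrightarrow> \<exists>c. proper_colouring G (chromatic_number G) c"
  unfolding chromatic_number_def by (rule LeastI[where P = "\<lambda>k. \<exists>c. proper_colouring G k c"]) blast

text \<open>Giving every vertex its own colour works. Hence the \<open>LEAST\<close> in
  \<open>chromatic_number\<close> is attained and minimum colourings exist.\<close>

lemma simple_graph_colourable:
  assumes "simple_graph G"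
  shows "\<exists>k c. proper_colouring G k c"
proof -
  obtain f :: "_ \<Rightarrow> nat" and k where f: "f ` verts G = {i. i < k}" "inj_on f (verts G)"
    using finite_imp_inj_to_nat_seg[of "verts G"] assms by (auto simp: simple_graph_def)
  have "f u \<noteq> f v" if "{u, v} \<in> edges G" for u v
  proof -
    have "u \<in> verts G" "v \<in> verts G" "u \<noteq> v"
      using that assms by (auto simp: simple_graph_def doubleton_eq_iff)
    then show ?thesis using f(2) by (auto simp: inj_on_def)
  qed
  moreover have "f v < k" if "v \<in> verts G" for v
    using f(1) that by blast
  ultimately have "proper_colouring G k (\<lambda>v. Suc (f v))"
    by (auto simp: proper_colouring_def Suc_le_eq)
  then show ?thesis by blast
qed

lemma sum_of_bool_subset:
  "finite A \<Longrightarrow> S \<subseteq> A \<Longrightarrow> (\<Sum>v\<in>A. if v \<in> S then 1 else 0 :: nat) = card S"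
  by (simp add: sum.If_cases Int_absorb1)

text \<open>Grouping vertices by colour gives a sum over vertices, a form in which each vertex can
  be paired with its partner.\<close>

lemma colouring_sum_eq:
  assumes "finite (verts G)" "minimum_colouring G c"
  shows "colouring_sum G c = (\<Sum>v\<in>verts G. c v)"
proof -
  let ?K = "{1..chromatic_number G}"
  have "c ` verts G \<subseteq> ?K"
    using assms(2) by (auto simp: minimum_colouring_def proper_colouring_def)
  then have "(\<Sum>v\<in>verts G. c v) = (\<Sum>i\<in>?K. \<Sum>v\<in>{v \<in> verts G. c v = i}. c v)"
    using assms(1) by (intro sum.group[symmetric]) auto
  also have "\<dots> = colouring_sum G c"
    unfolding colouring_sum_def colour_weight_def by (intro sum.cong) auto
  finally show ?thesis ..
qed

text \<open>A colouring is arbitrary off the vertex set, so there may be infinitely many colourings;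
  their sums are nevertheless bounded.\<close>

lemma finite_colouring_sums:
  assumes "finite (verts G)"
  shows "finite {colouring_sum G c | c. minimum_colouring G c}"
proof (rule finite_subset)
  show "{colouring_sum G c | c. minimum_colouring G c} \<subseteq> {..card (verts G) * chromatic_number G}"
  proof
    fix x assume "x \<in> {colouring_sum G c | c. minimum_colouring G c}"
    then obtain c where c: "minimum_colouring G c" and x: "x = colouring_sum G c" by blast
    then have "(\<Sum>v\<in>verts G. c v) \<le> card (verts G) * chromatic_number G"
      using sum_bounded_above[of "verts G" c "chromatic_number G"]
      by (simp add: minimum_colouring_def proper_colouring_def)
    then show "x \<in> {..card (verts G) * chromatic_number G}"
      using colouring_sum_eq[OF assms c] x by simp
  qed
qed simp

lemma finite_complete_extensions:
  assumes "finite (verts G)"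
  shows "finite (complete_extensions G)"
proof -
  have "edges (complement G) \<subseteq> Pow (verts G)"
    by (auto simp: complement_def)
  then have "finite (edges (complement G))"
    using assms by (meson finite_Pow_iff finite_subset)
  moreover have "complete_extensions G \<subseteq> add_edges G ` Pow (edges (complement G))"
    by (auto simp: complete_extensions_def perfect_matching_def)
  ultimately show ?thesis by (meson finite_Pow_iff finite_imageI finite_subset)
qed

section \<open>Extremal values from a uniform bound and one colouring attaining it\<close>

context
  fixes G H :: "'a graph" and c :: "'a \<Rightarrow> nat" and m :: nat
  assumes G: "simple_graph G"
    and H: "H \<in> complete_extensions G" "minimum_colouring H c" "colouring_sum H c = m"
begin

lemma extension_sums_finite_nonempty:
  assumes "K \<in> complete_extensions G"
  shows "finite {colouring_sum K c | c. minimum_colouring K c}"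
    and "{colouring_sum K c | c. minimum_colouring K c} \<noteq> {}"
proof -
  have K: "simple_graph K" using simple_graph_extension[OF G assms] .
  then show "finite {colouring_sum K c | c. minimum_colouring K c}"
    by (simp add: finite_colouring_sums simple_graph_def)
  show "{colouring_sum K c | c. minimum_colouring K c} \<noteq> {}"
    using simple_graph_colourable[OF K] proper_colouring_chromatic_number
    unfolding minimum_colouring_def by fastforce
qed

text \<open>Both nested minima are settled at once: the bound passes to every
  \<open>min_chromatic_sum\<close>, and the witness \<open>c\<close> forces equality at
  \<open>H\<close>.\<close>

lemma min_extension_sum_eqI:
  assumes "\<And>K d. K \<in> complete_extensions G \<Longrightarrow> minimum_colouring K d \<Longrightarrow> m \<le> colouring_sum K d"
  shows "min_extension_sum G = m"
proof -
  have ge: "m \<le> min_chromatic_sum K" if "K \<in> complete_extensions G" for K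
    unfolding min_chromatic_sum_def
    using extension_sums_finite_nonempty[OF that] assms[OF that] by (subst Min_ge_iff) auto
  have "min_chromatic_sum H \<le> m"
    unfolding min_chromatic_sum_def
    using extension_sums_finite_nonempty(1)[OF H(1)] H by (intro Min_le) auto
  with ge[OF H(1)] have "min_chromatic_sum H = m" by simp
  then show ?thesis
    unfolding min_extension_sum_def
    using finite_complete_extensions G H(1) ge by (intro Min_eqI) (auto simp: simple_graph_def)
qed

lemma max_extension_sum_eqI:
  assumes "\<And>K d. K \<in> complete_extensions G \<Longrightarrow> minimum_colouring K d \<Longrightarrow> colouring_sum K d \<le> m"
  shows "max_extension_sum G = m"
proof -
  have le: "max_chromatic_sum K \<le> m" if "K \<in> complete_extensions G" for K
    unfolding max_chromatic_sum_def
    using extension_sums_finite_nonempty[OF that] assms[OF that] by (subst Max_le_iff) auto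
  have "m \<le> max_chromatic_sum H"
    unfolding max_chromatic_sum_def
    using extension_sums_finite_nonempty(1)[OF H(1)] H by (intro Max_ge) auto
  with le[OF H(1)] have "max_chromatic_sum H = m" by simp
  then show ?thesis
    unfolding max_extension_sum_def
    using finite_complete_extensions G H(1) le by (intro Max_eqI) (auto simp: simple_graph_def)
qed

end

section \<open>Perfect matchings as involutions\<close>

lemma perfect_matching_iff_involution:
  assumes "simple_graph G"
  shows "perfect_matching G M \<longleftrightarrow>
    (\<exists>p. (\<forall>v\<in>verts G. p (p v) = v \<and> {v, p v} \<in> edges G) \<and> M = {{v, p v} | v. v \<in> verts G})"
    (is "?L \<longleftrightarrow> ?R")
proof
  assume L: ?L
  have edge: "\<exists>u v. e = {u, v} \<and> u \<in> verts G \<and> v \<in> verts G \<and> u \<noteq> v" if "e \<in> M" for e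
    using that L assms by (auto simp: perfect_matching_def simple_graph_def)
  have ex1: "\<exists>!e. e \<in> M \<and> v \<in> e" if "v \<in> verts G" for v
    using L that by (simp add: perfect_matching_def)
  have "\<exists>w. {v, w} \<in> M" if v: "v \<in> verts G" for v
  proof -
    obtain e where e: "e \<in> M" "v \<in> e" using ex1[OF v] by (meson ex1_implies_ex)
    with edge[OF e(1)] show ?thesis by (metis insertE insert_commute singletonD)
  qed
  then obtain p where p: "\<And>v. v \<in> verts G \<Longrightarrow> {v, p v} \<in> M" by metis
  \<comment> \<open>Applied to the edge \<open>{v, p v}\<close> at its other end, this uniqueness
    makes \<open>p\<close> an involution.\<close>
  have uniq: "e = {v, p v}" if "e \<in> M" "v \<in> e" "v \<in> verts G" for e v
    using ex1[OF that(3)] p[OF that(3)] that(1,2) by (elim ex1E) (metis insertI1)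
  have pv: "p v \<in> verts G" if "v \<in> verts G" for v
    using edge[OF p[OF that]] by (auto simp: doubleton_eq_iff)
  have "p (p v) = v" if "v \<in> verts G" for v
    using uniq[OF p[OF that] _ pv[OF that]] by (auto simp: doubleton_eq_iff)
  moreover have "{v, p v} \<in> edges G" if "v \<in> verts G" for v
    using p[OF that] L by (auto simp: perfect_matching_def)
  moreover have "M = {{v, p v} | v. v \<in> verts G}"
  proof
    show "M \<subseteq> {{v, p v} | v. v \<in> verts G}"
    proof
      fix e assume e: "e \<in> M"
      with edge[OF e] uniq[OF e] show "e \<in> {{v, p v} | v. v \<in> verts G}" by blast
    qed
  qed (use p in auto)
  ultimately show ?R by blast
next
  assume ?R
  then obtain p where p: "\<And>v. v \<in> verts G \<Longrightarrow> p (p v) = v"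
      "\<And>v. v \<in> verts G \<Longrightarrow> {v, p v} \<in> edges G"
    and M: "M = {{v, p v} | v. v \<in> verts G}" by blast
  have "\<exists>!e. e \<in> M \<and> v \<in> e" if "v \<in> verts G" for v
  proof
    show "{v, p v} \<in> M \<and> v \<in> {v, p v}" using that M by auto
    show "e = {v, p v}" if e: "e \<in> M \<and> v \<in> e" for e
    proof -
      \<comment> \<open>Either \<open>v = w\<close>, or \<open>v = p w\<close>; in the second case
        \<open>p v = w\<close>, so the edge is the same.\<close>
      obtain w where w: "w \<in> verts G" "e = {w, p w}" using e M by blast
      then show ?thesis using e p(1)[OF w(1)] by (auto simp: doubleton_eq_iff)
    qed
  qed
  then show ?L using p(2) M by (auto simp: perfect_matching_def)
qed

lemma simple_graph_complement: "simple_graph G \<Longrightarrow> simple_graph (complement G)"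
  by (auto simp: simple_graph_def complement_def)

lemma path_graph_edge_iff:
  "{u, v} \<in> edges (path_graph n) \<longleftrightarrow> u \<in> {1..n} \<and> v \<in> {1..n} \<and> (v = Suc u \<or> u = Suc v)"
  by (auto simp: path_graph_def doubleton_eq_iff)

text \<open>The inequations say that \<open>v\<close> and \<open>p v\<close> are distinct and not
  consecutive on the path, that is, adjacent in its complement. Outside \<open>{1..n}\<close> the
  values of \<open>p\<close> are arbitrary.\<close>

definition path_involution :: "nat \<Rightarrow> (nat \<Rightarrow> nat) \<Rightarrow> bool" where
  "path_involution n p \<longleftrightarrow> (\<forall>v\<in>{1..n}. p v \<in> {1..n} \<and> p (p v) = v \<and>
     p v \<noteq> v \<and> p v \<noteq> Suc v \<and> v \<noteq> Suc (p v))"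

definition path_extension :: "nat \<Rightarrow> (nat \<Rightarrow> nat) \<Rightarrow> nat graph" where
  "path_extension n p = add_edges (path_graph n) {{v, p v} | v. v \<in> {1..n}}"

lemma complete_extensions_path_graph:
  "complete_extensions (path_graph n) = {path_extension n p | p. path_involution n p}"
proof -
  have "{v, p v} \<in> edges (complement (path_graph n)) \<longleftrightarrow>
      p v \<in> {1..n} \<and> p v \<noteq> v \<and> p v \<noteq> Suc v \<and> v \<noteq> Suc (p v)" if "v \<in> {1..n}" for v p
  proof -
    have "{v, p v} \<in> edges (complement (path_graph n)) \<longleftrightarrow>
        v \<in> {1..n} \<and> p v \<in> {1..n} \<and> p v \<noteq> v \<and> {v, p v} \<notin> edges (path_graph n)"
      by (auto simp: complement_def path_graph_def doubleton_eq_iff insert_commute)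
    then show ?thesis using that by (auto simp: path_graph_edge_iff)
  qed
  then have "(\<forall>v\<in>{1..n}. p (p v) = v \<and> {v, p v} \<in> edges (complement (path_graph n)))
      \<longleftrightarrow> path_involution n p" for p
    unfolding path_involution_def by blast
  moreover have "verts (complement (path_graph n)) = {1..n}"
    by (simp add: complement_def path_graph_def)
  ultimately show ?thesis
    unfolding complete_extensions_def path_extension_def
    using perfect_matching_iff_involution[OF simple_graph_complement[OF simple_graph_path_graph]]
    by auto
qed

lemma verts_path_extension [simp]: "verts (path_extension n p) = {1..n}"
  by (simp add: path_extension_def add_edges_def path_graph_def)

text \<open>Because \<open>p\<close> is an involution, \<open>v = p u\<close> is symmetric in
  \<open>u\<close> and \<open>v\<close>, so one clause describes the unordered matching
  edges.\<close>

lemma path_extension_edge_iff: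
  assumes "path_involution n p"
  shows "{u, v} \<in> edges (path_extension n p) \<longleftrightarrow>
    u \<in> {1..n} \<and> v \<in> {1..n} \<and> (v = Suc u \<or> u = Suc v \<or> v = p u)"
proof -
  have "{u, v} \<in> edges (path_extension n p) \<longleftrightarrow>
      {u, v} \<in> edges (path_graph n) \<or> (\<exists>w\<in>{1..n}. {u, v} = {w, p w})"
    unfolding path_extension_def add_edges_def graph.simps Un_iff mem_Collect_eq by blast
  also have "(\<exists>w\<in>{1..n}. {u, v} = {w, p w}) \<longleftrightarrow> u \<in> {1..n} \<and> v \<in> {1..n} \<and> v = p u"
  proof
    assume "\<exists>w\<in>{1..n}. {u, v} = {w, p w}"
    then obtain w where "w \<in> {1..n}" "u = w \<and> v = p w \<or> u = p w \<and> v = w"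
      by (meson doubleton_eq_iff)
    then show "u \<in> {1..n} \<and> v \<in> {1..n} \<and> v = p u"
      using assms unfolding path_involution_def by metis
  qed blast
  finally show ?thesis by (auto simp: path_graph_edge_iff)
qed

text \<open>A path edge is tested at its lower end only, inequality being symmetric;
  \<open>v < n\<close> excludes the last vertex, which has no successor.\<close>

lemma proper_colouring_path_extension_iff:
  assumes "path_involution n p"
  shows "proper_colouring (path_extension n p) k c \<longleftrightarrow>
    (\<forall>v\<in>{1..n}. c v \<in> {1..k} \<and> c v \<noteq> c (p v) \<and> (v < n \<longrightarrow> c v \<noteq> c (Suc v)))"
    (is "?L \<longleftrightarrow> ?R")
proof
  assume ?L
  then show ?R
    using assms unfolding proper_colouring_def path_extension_edge_iff[OF assms]
    by (auto simp: path_involution_def)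
next
  assume R: ?R
  have "c u \<noteq> c v" if "{u, v} \<in> edges (path_extension n p)" for u v
    using that R assms unfolding path_extension_edge_iff[OF assms] by fastforce
  with R show ?L by (simp add: proper_colouring_def)
qed

section \<open>Bounds valid for every extension of the path\<close>

lemma path_extension_3_colourable:
  assumes p: "path_involution n p"
  shows "\<exists>c. proper_colouring (path_extension n p) 3 c"
proof -
  \<comment> \<open>Induction on the initial segment coloured so far. The range condition holds
    everywhere, so vertices not yet reached carry placeholder colours.\<close>
  have "\<exists>c :: nat \<Rightarrow> nat. (\<forall>v. c v \<in> {1..3}) \<and>
      (\<forall>u\<in>{1..m}. \<forall>v\<in>{1..m}. u = Suc v \<or> v = p u \<longrightarrow> c u \<noteq> c v)" if "m \<le> n" for m
    using that
  proof (induction m)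
    case 0
    show ?case by (rule exI[of _ "\<lambda>_. 1"]) auto
  next
    case (Suc m)
    then obtain c :: "nat \<Rightarrow> nat" where c: "\<And>v. c v \<in> {1..3}"
      "\<And>u v. \<lbrakk>u \<in> {1..m}; v \<in> {1..m}; u = Suc v \<or> v = p u\<rbrakk> \<Longrightarrow> c u \<noteq> c v"
      by (metis Suc_leD)
    \<comment> \<open>One of three colours differs from those of the predecessor and the partner. If
      either is not among the coloured vertices, avoiding its placeholder does no harm.\<close>
    have "\<exists>x\<in>{1, 2, 3}. x \<noteq> c m \<and> x \<noteq> c (p (Suc m))" by auto
    then obtain x where "x \<in> {1, 2, 3}" "x \<noteq> c m" "x \<noteq> c (p (Suc m))" by blast
    then have x: "x \<in> {1..3}" "x \<noteq> c m" "x \<noteq> c (p (Suc m))" by auto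
    have inv: "p (Suc m) \<noteq> Suc m" "\<And>v. v \<in> {1..n} \<Longrightarrow> p (p v) = v"
      using p Suc.prems by (auto simp: path_involution_def)
    show ?case
    proof (intro exI[of _ "c(Suc m := x)"] conjI ballI impI allI)
      fix u v assume uv: "u \<in> {1..Suc m}" "v \<in> {1..Suc m}" "u = Suc v \<or> v = p u"
      consider "u \<le> m" "v \<le> m" | "u = Suc m" "v \<le> m" | "v = Suc m" "u \<le> m" | "u = Suc m" "v = Suc m"
        using uv by fastforce
      then show "(c(Suc m := x)) u \<noteq> (c(Suc m := x)) v"
      proof cases
        case 1
        then show ?thesis using uv c(2)[of u v] by auto
      next
        case 2
        then show ?thesis using uv x by auto
      next
        case 3
        \<comment> \<open>Here \<open>u = Suc v\<close> is impossible, so the edge is a matching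
          edge, read from its other end by involutivity.\<close>
        then have "u = p (Suc m)" using uv inv(2)[of u] Suc.prems by auto
        then show ?thesis using 3 x by auto
      next
        case 4
        then show ?thesis using uv inv by auto
      qed
    qed (use c x in auto)
  qed
  from this[of n] obtain c :: "nat \<Rightarrow> nat" where c: "\<And>v. c v \<in> {1..3}"
    "\<And>u v. \<lbrakk>u \<in> {1..n}; v \<in> {1..n}; u = Suc v \<or> v = p u\<rbrakk> \<Longrightarrow> c u \<noteq> c v" by blast
  have "c v \<noteq> c (Suc v)" if "v \<in> {1..n}" "v < n" for v
    using c(2)[of "Suc v" v] that by auto
  moreover have "c v \<noteq> c (p v)" if "v \<in> {1..n}" for v
    using c(2)[of v "p v"] p that by (auto simp: path_involution_def)
  ultimately have "proper_colouring (path_extension n p) 3 c"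
    unfolding proper_colouring_path_extension_iff[OF p] using c(1) by blast
  then show ?thesis by blast
qed

text \<open>\<open>p\<close> permutes \<open>{1..n}\<close>, so composing with it does not change
  the sum.\<close>

lemma sum_path_involution:
  fixes c :: "nat \<Rightarrow> nat"
  assumes "path_involution n p"
  shows "(\<Sum>v\<in>{1..n}. c v + c (p v)) = 2 * (\<Sum>v\<in>{1..n}. c v)"
proof -
  have "(\<Sum>v\<in>{1..n}. c (p v)) = (\<Sum>v\<in>{1..n}. c v)"
    using assms by (intro sum.reindex_bij_witness[of _ p p]) (auto simp: path_involution_def)
  then show ?thesis by (simp add: sum.distrib)
qed

text \<open>If colour 1 were missing, lowering every colour by one would save a colour, against
  minimality.\<close>

lemma minimum_colouring_uses_1:
  assumes c: "minimum_colouring G c" and "verts G \<noteq> {}" "simple_graph G"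
  shows "\<exists>v\<in>verts G. c v = 1"
proof (rule ccontr)
  assume no: "\<not> ?thesis"
  let ?k = "chromatic_number G"
  have range: "c v \<in> {2..?k}" if "v \<in> verts G" for v
    using c no that by (force simp: minimum_colouring_def proper_colouring_def le_less)
  have "c u - 1 \<noteq> c v - 1" if e: "{u, v} \<in> edges G" for u v
  proof -
    have "u \<in> verts G" "v \<in> verts G"
      using e assms(3) by (auto simp: simple_graph_def doubleton_eq_iff)
    moreover have "c u \<noteq> c v"
      using e c by (auto simp: minimum_colouring_def proper_colouring_def)
    ultimately show ?thesis using range[of u] range[of v] by auto
  qed
  then have "proper_colouring G (?k - 1) (\<lambda>v. c v - 1)"
    using range by (fastforce simp: proper_colouring_def)
  \<comment> \<open>Some vertex has a colour in \<open>{2..?k}\<close>, so \<open>?k - 1\<close> is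
    strictly below \<open>?k\<close> despite truncated subtraction.\<close>
  from chromatic_number_le[OF this] range assms(2) show False by fastforce
qed

lemma path_extension_in_complete_extensions:
  "path_involution n p \<Longrightarrow> path_extension n p \<in> complete_extensions (path_graph n)"
  by (auto simp: complete_extensions_path_graph)

lemma colouring_sum_path_extension:
  "minimum_colouring (path_extension n p) c \<Longrightarrow>
    colouring_sum (path_extension n p) c = (\<Sum>v\<in>{1..n}. c v)"
  by (simp add: colouring_sum_eq)

text \<open>Partners have distinct positive colours, which add up to at least 1 + 2. Doubling the
  sum avoids division.\<close>

lemma path_extension_sum_ge:
  assumes p: "path_involution n p" and c: "minimum_colouring (path_extension n p) c"
  shows "3 * n \<le> 2 * colouring_sum (path_extension n p) c"
proof -
  have "3 \<le> c v + c (p v)" if v: "v \<in> {1..n}" for v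
  proof -
    have "p v \<in> {1..n}" using p v by (auto simp: path_involution_def)
    then have "1 \<le> c v" "1 \<le> c (p v)" "c v \<noteq> c (p v)"
      using c v unfolding minimum_colouring_def proper_colouring_path_extension_iff[OF p] by auto
    then show ?thesis by linarith
  qed
  then have "(\<Sum>v\<in>{1..n}. 3) \<le> (\<Sum>v\<in>{1..n}. c v + c (p v))" by (intro sum_mono)
  then show ?thesis
    unfolding sum_path_involution[OF p] colouring_sum_path_extension[OF c] by simp
qed

lemma path_extension_sum_le:
  assumes p: "path_involution n p" and c: "minimum_colouring (path_extension n p) c" and n: "1 \<le> n"
  shows "2 * colouring_sum (path_extension n p) c + 2 \<le> 5 * n"
proof -
  have "chromatic_number (path_extension n p) \<le> 3"
    using path_extension_3_colourable[OF p] chromatic_number_le by blast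
  then have c3: "c v \<le> 3" "c v \<noteq> c (p v)" if "v \<in> {1..n}" for v
    using c that unfolding minimum_colouring_def proper_colouring_path_extension_iff[OF p]
    by fastforce+
  have p': "p v \<in> {1..n}" "p (p v) = v" "p v \<noteq> v" if "v \<in> {1..n}" for v
    using p that by (auto simp: path_involution_def)
  have "simple_graph (path_extension n p)"
    using simple_graph_extension[OF simple_graph_path_graph path_extension_in_complete_extensions[OF p]] .
  with minimum_colouring_uses_1[OF c] n obtain w where w: "w \<in> {1..n}" "c w = 1" by auto
  \<comment> \<open>A pair reaches at most 2 + 3, but the pair containing the colour-1 vertex
    \<open>w\<close> at most 1 + 3. The added term records this loss at both \<open>w\<close> and
    \<open>p w\<close>.\<close>
  have "c v + c (p v) + (if v \<in> {w, p w} then 1 else 0) \<le> 5" if v: "v \<in> {1..n}" for v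
    using c3(1)[OF v] c3(2)[OF v] c3(1)[OF p'(1)[OF v]] w(2) p'(2)[OF w(1)] by auto
  then have "(\<Sum>v\<in>{1..n}. c v + c (p v) + (if v \<in> {w, p w} then 1 else 0)) \<le> (\<Sum>v\<in>{1..n}. 5)"
    by (intro sum_mono)
  moreover have "(\<Sum>v\<in>{1..n}. if v \<in> {w, p w} then 1 else 0 :: nat) = 2"
    using w(1) p'[OF w(1)] by (subst sum_of_bool_subset) auto
  ultimately show ?thesis
    using sum_path_involution[OF p, of c]
    unfolding colouring_sum_path_extension[OF c]
    by (simp only: sum.distrib) simp
qed

section \<open>Extensions attaining the bounds\<close>

lemma min_extension_sum_path:
  assumes "6 \<le> n" "even n"
  shows "2 * min_extension_sum (path_graph n) = 3 * n"
proof -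
  \<comment> \<open>Odd \<open>v\<close> is matched with \<open>v + 3\<close>, and the leftover
    \<open>n - 1\<close> with 2; for \<open>n = 4\<close> these two would be neighbours. Partners
    have opposite parity, so the extension stays bipartite and colouring by parity gives every pair
    the sum 3.\<close>
  define p where "p v = (if odd v then (if v = n - 1 then 2 else v + 3)
    else (if v = 2 then n - 1 else v - 3))" for v
  define c :: "nat \<Rightarrow> nat" where "c v = (if odd v then 1 else 2)" for v
  let ?H = "path_extension n p"
  have p: "path_involution n p"
    unfolding path_involution_def
  proof
    fix v assume v: "v \<in> {1..n}"
    then have "v = n - 1 \<or> (odd v \<and> v + 3 \<le> n) \<or> v = 2 \<or> (even v \<and> 4 \<le> v)"
      using assms unfolding atLeastAtMost_iff by presburger
    then show "p v \<in> {1..n} \<and> p (p v) = v \<and> p v \<noteq> v \<and> p v \<noteq> Suc v \<and> v \<noteq> Suc (p v)"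
      using v assms by (elim disjE) (auto simp: p_def)
  qed
  have odd_p: "odd (p v) \<longleftrightarrow> even v" if "v \<in> {1..n}" for v
    using that assms by (auto simp: p_def)
  have col: "proper_colouring ?H 2 c"
    unfolding proper_colouring_path_extension_iff[OF p] using odd_p by (auto simp: c_def)
  have "2 \<le> chromatic_number ?H"
  proof -
    obtain d where d: "proper_colouring ?H (chromatic_number ?H) d"
      using proper_colouring_chromatic_number[OF col] by blast
    then have "d 1 \<in> {1..chromatic_number ?H}" "d 2 \<in> {1..chromatic_number ?H}" "d 1 \<noteq> d 2"
      using assms unfolding proper_colouring_path_extension_iff[OF p]
      by (auto simp: numeral_2_eq_2)
    then show ?thesis by auto
  qed
  with chromatic_number_le[OF col] col have c: "minimum_colouring ?H c"
    by (simp add: minimum_colouring_def)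
  have "(\<Sum>v\<in>{1..n}. c v + c (p v)) = (\<Sum>v\<in>{1..n}. 3)"
    using odd_p by (intro sum.cong) (auto simp: c_def)
  then have eq: "2 * colouring_sum ?H c = 3 * n"
    unfolding sum_path_involution[OF p] colouring_sum_path_extension[OF c] by simp
  have "min_extension_sum (path_graph n) = colouring_sum ?H c"
  proof (rule min_extension_sum_eqI[OF simple_graph_path_graph
        path_extension_in_complete_extensions[OF p] c refl])
    fix K d assume "K \<in> complete_extensions (path_graph n)" "minimum_colouring K d"
    then show "colouring_sum ?H c \<le> colouring_sum K d"
      using path_extension_sum_ge[of n _ d] eq by (fastforce simp: complete_extensions_path_graph)
  qed
  with eq show ?thesis by simp
qed

text \<open>The triangle on the vertices 2, 3, 4 makes this extension 3-chromatic.\<close>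

lemma chromatic_number_path_extension_eq_3:
  assumes p: "path_involution n p" and "4 \<le> n" "p 2 = 4"
  shows "chromatic_number (path_extension n p) = 3"
proof (rule antisym)
  let ?k = "chromatic_number (path_extension n p)"
  obtain c where c: "proper_colouring (path_extension n p) 3 c"
    using path_extension_3_colourable[OF p] by blast
  then show "?k \<le> 3" by (rule chromatic_number_le)
  obtain d where "proper_colouring (path_extension n p) ?k d"
    using proper_colouring_chromatic_number[OF c] by blast
  then have d: "\<And>v. v \<in> {1..n} \<Longrightarrow> d v \<in> {1..?k} \<and> d v \<noteq> d (p v) \<and> (v < n \<longrightarrow> d v \<noteq> d (Suc v))"
    unfolding proper_colouring_path_extension_iff[OF p] by blast
  show "3 \<le> ?k"
    using d[of 2] d[of 3] d[of 4] assms by (auto simp: eval_nat_numeral)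
qed

text \<open>This includes \<open>n = 4\<close>, where \<open>n - 1 = 3\<close> and the involution
  below swaps 1 with 3 and 2 with 4.\<close>

lemma max_extension_sum_path:
  assumes "4 \<le> n" "even n"
  shows "2 * max_extension_sum (path_graph n) + 2 = 5 * n"
proof -
  \<comment> \<open>The pair 2, 4 creates a triangle with 3 and so forces three colours. Then 1 goes
    with \<open>n - 1\<close>, and each odd \<open>v\<close> from 3 to \<open>n - 3\<close> with
    \<open>v + 3\<close>.\<close>
  define p where "p v = (if v = 2 then 4 else if v = 4 then 2 else if v = 1 then n - 1
    else if v = n - 1 then 1 else if odd v then v + 3 else v - 3)" for v
  \<comment> \<open>Colour 1 is spent only on vertex 2, whose partner 4 has colour 3; every other
    pair has colours 2 and 3.\<close>
  define c :: "nat \<Rightarrow> nat"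
    where "c v = (if v = 2 then 1 else if v = 1 \<or> even v then 3 else 2)" for v
  let ?H = "path_extension n p"
  have cases: "v = 2 \<or> v = 4 \<or> v = 1 \<or> (v = n - 1 \<and> v \<noteq> 1) \<or> (odd v \<and> 3 \<le> v \<and> v + 3 \<le> n)
      \<or> (even v \<and> 6 \<le> v)" if "v \<in> {1..n}" for v
    using that assms unfolding atLeastAtMost_iff by presburger
  have p: "path_involution n p"
    unfolding path_involution_def
  proof
    fix v assume v: "v \<in> {1..n}"
    show "p v \<in> {1..n} \<and> p (p v) = v \<and> p v \<noteq> v \<and> p v \<noteq> Suc v \<and> v \<noteq> Suc (p v)"
      using cases[OF v] v assms by (elim disjE) (auto simp: p_def, presburger+)
  qed
  \<comment> \<open>This is the pairwise estimate behind the upper bound, now with equality at every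
    vertex.\<close>
  have sum5: "c v + c (p v) + (if v \<in> {2, 4} then 1 else 0) = 5 \<and> c v \<noteq> c (p v)"
    if v: "v \<in> {1..n}" for v
    using cases[OF v] v assms by (elim disjE) (auto simp: p_def c_def, presburger+)
  have col: "proper_colouring ?H 3 c"
    unfolding proper_colouring_path_extension_iff[OF p]
    using sum5 by (auto simp: c_def)
  then have c: "minimum_colouring ?H c"
    using chromatic_number_path_extension_eq_3[OF p] assms
    by (simp add: minimum_colouring_def p_def)
  have "(\<Sum>v\<in>{1..n}. c v + c (p v) + (if v \<in> {2, 4} then 1 else 0)) = (\<Sum>v\<in>{1..n}. 5)"
    using sum5 by (intro sum.cong) auto
  moreover have "(\<Sum>v\<in>{1..n}. if v \<in> {2, 4} then 1 else 0 :: nat) = 2"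
    using assms by (subst sum_of_bool_subset) auto
  ultimately have eq: "2 * colouring_sum ?H c + 2 = 5 * n"
    using sum_path_involution[OF p, of c]
    unfolding colouring_sum_path_extension[OF c]
    by (simp only: sum.distrib) simp
  have "max_extension_sum (path_graph n) = colouring_sum ?H c"
  proof (rule max_extension_sum_eqI[OF simple_graph_path_graph
        path_extension_in_complete_extensions[OF p] c refl])
    fix K d assume "K \<in> complete_extensions (path_graph n)" "minimum_colouring K d"
    then show "colouring_sum K d \<le> colouring_sum ?H c"
      using path_extension_sum_le[of n _ d] eq assms
      by (fastforce simp: complete_extensions_path_graph)
  qed
  with eq show ?thesis by simp
qed

section \<open>The path on four vertices\<close>

lemma atLeastAtMost_1_4: "{1..4 :: nat} = {1, 2, 3, 4}"
  by auto

text \<open>The complement is again a path, visiting 3, 1, 4, 2, and therefore has exactly one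
  perfect matching.\<close>

lemma path_involution_4_iff:
  "path_involution 4 p \<longleftrightarrow> p 1 = 3 \<and> p 2 = 4 \<and> p 3 = 1 \<and> p 4 = 2"
proof
  assume p: "path_involution 4 p"
  then have "p 2 = 4" "p 3 = 1" unfolding path_involution_def atLeastAtMost_1_4 by auto
  with p show "p 1 = 3 \<and> p 2 = 4 \<and> p 3 = 1 \<and> p 4 = 2"
    unfolding path_involution_def atLeastAtMost_1_4 by auto
next
  assume "p 1 = 3 \<and> p 2 = 4 \<and> p 3 = 1 \<and> p 4 = 2"
  then show "path_involution 4 p"
    unfolding path_involution_def atLeastAtMost_1_4 by auto
qed

text \<open>The five inequations are the edges of the complete graph without the edge between 1 and
  4.\<close>

lemma proper_colouring_path_extension_4_iff:
  assumes "path_involution 4 p"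
  shows "proper_colouring (path_extension 4 p) k c \<longleftrightarrow>
    (\<forall>v\<in>{1..4}. c v \<in> {1..k}) \<and>
    c 1 \<noteq> c 2 \<and> c 2 \<noteq> c 3 \<and> c 3 \<noteq> c 4 \<and> c 1 \<noteq> c 3 \<and> c 2 \<noteq> c 4"
  using assms unfolding proper_colouring_path_extension_iff[OF assms] path_involution_4_iff
    atLeastAtMost_1_4
  by (auto simp: eval_nat_numeral)

text \<open>The general lower bound 6 would need every pair coloured 1 and 2, but a triangle forces
  a third colour.\<close>

lemma min_extension_sum_path_4: "min_extension_sum (path_graph 4) = 7"
proof -
  define p :: "nat \<Rightarrow> nat" where "p v = (if v \<le> 2 then v + 2 else v - 2)" for v
  \<comment> \<open>The nonadjacent vertices 1 and 4 share colour 1, giving 1 + 2 + 3 + 1.\<close>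
  define c :: "nat \<Rightarrow> nat" where "c v = (if v = 4 then 1 else v)" for v
  have p: "path_involution 4 p" by (simp add: path_involution_4_iff p_def)
  have "chromatic_number (path_extension 4 p) = 3"
    using chromatic_number_path_extension_eq_3[OF p] by (simp add: p_def)
  then have c: "minimum_colouring (path_extension 4 p) c"
    by (simp add: minimum_colouring_def proper_colouring_path_extension_4_iff[OF p] c_def)
  show ?thesis
  proof (rule min_extension_sum_eqI[OF simple_graph_path_graph
        path_extension_in_complete_extensions[OF p] c])
    show "colouring_sum (path_extension 4 p) c = 7"
      unfolding colouring_sum_path_extension[OF c] atLeastAtMost_1_4 by (simp add: c_def)
    fix K d assume "K \<in> complete_extensions (path_graph 4)" and d: "minimum_colouring K d"
    then obtain q where q: "path_involution 4 q" and K: "K = path_extension 4 q"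
      by (auto simp: complete_extensions_path_graph)
    have "1 \<le> d 1" "1 \<le> d 2" "1 \<le> d 3" "1 \<le> d 4"
        "d 1 \<noteq> d 2" "d 2 \<noteq> d 3" "d 3 \<noteq> d 4" "d 1 \<noteq> d 3" "d 2 \<noteq> d 4"
      using d unfolding K minimum_colouring_def proper_colouring_path_extension_4_iff[OF q]
      by auto
    \<comment> \<open>The triangle 1, 2, 3 contributes at least 1 + 2 + 3, and vertex 4 at least
      1.\<close>
    then have "7 \<le> d 1 + d 2 + d 3 + d 4" by linarith
    then show "7 \<le> colouring_sum K d"
      using d unfolding K by (subst colouring_sum_path_extension) (auto simp only: atLeastAtMost_1_4, simp)
  qed
qed

theorem theorem3p3:
  fixes n :: nat
  assumes "n \<ge> 4" and "even n"
  shows "(n = 4 \<longrightarrow>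
            min_extension_sum (path_graph n) = 7 \<and>
            max_extension_sum (path_graph n) = 9) \<and>
         (n \<ge> 6 \<longrightarrow>
            real (min_extension_sum (path_graph n)) = 3 * real n / 2 \<and>
            real (max_extension_sum (path_graph n)) = 5 * real n / 2 - 1)"
proof -
  have "2 * max_extension_sum (path_graph n) + 2 = 5 * n"
    using max_extension_sum_path assms .
  moreover from this have "real (max_extension_sum (path_graph n)) = 5 * real n / 2 - 1"
    by linarith
  moreover have "real (min_extension_sum (path_graph n)) = 3 * real n / 2" if "n \<ge> 6"
    using min_extension_sum_path[OF that assms(2)] by linarith
  ultimately show ?thesis using min_extension_sum_path_4 by auto
qed

end
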